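(* Let $n\ge2$, $\lambda\in\mathbb{R}$, let $\mu$ be a positive Borel measure on $S^{n-1}$, and let $u(x)=\int_{S^{n-1}}P_\lambda(x,\xi)\,d\mu(\xi)$, $x\in B^n$, be the positive invariant harmonic function in $B^n$ defined by $\mu$ with the Poisson kernel $P_\lambda$. Let $0\le r'\le r<1$. If $\lambda>-\frac n2$, then $$\frac{(1-r)^{n-1}}{(1+r)^{1+2\lambda}}\max_{|x|=r}u(x)\le\frac{(1-r')^{n-1}}{(1+r')^{1+2\lambda}}\max_{|x|=r'}u(x),$$ $$\frac{(1+r)^{n-1}}{(1-r)^{1+2\lambda}}\min_{|x|=r}u(x)\ge\frac{(1+r')^{n-1}}{(1-r')^{1+2\lambda}}\min_{|x|=r'}u(x).$$ If $\lambda<-\frac n2$, then $$\frac{(1+r)^{n-1}}{(1-r)^{1+2\lambda}}\max_{|x|=r}u(x)\le\frac{(1+r')^{n-1}}{(1-r')^{1+2\lambda}}\max_{|x|=r'}u(x),$$ $$\frac{(1-r)^{n-1}}{(1+r)^{1+2\lambda}}\min_{|x|=r}u(x)\ge\frac{(1-r')^{n-1}}{(1+r')^{1+2\lambda}}\min_{|x|=r'}u(x).$$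
   Context: $B^n=\{x\in\mathbb{R}^n:|x|<1\}$, $S^{n-1}=\partial B^n$. The Poisson kernel is $P_\lambda(x,\zeta)=\dfrac{(1-|x|^2)^{1+2\lambda}}{|x-\zeta|^{n+2\lambda}}$ for $x\in B^n$, $\zeta\in S^{n-1}$. Invariant harmonic functions are the solutions of $\Delta_\lambda u=0$, where $\Delta_\lambda=(1-|x|^2)\left\{\frac{1-|x|^2}{4}\sum_j\frac{\partial^2}{\partial x_j^2}+\lambda\sum_j x_j\frac{\partial}{\partial x_j}+\lambda\left(\frac n2-1-\lambda\right)\right\}$; integrals of $P_\lambda$ against $\mu$ are known to be invariant harmonic. That $u$ is a positive function means $0<u(x)<\infty$ for all $x\in B^n$ (so $\mu$ is finite and nonzero). *)

theory Defs
  imports "HOL-Analysis.Analysis"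
begin

definition poisson_kernel :: "real \<Rightarrow> real ^ 'n \<Rightarrow> real ^ 'n \<Rightarrow> real" where
  "poisson_kernel lam x \<zeta> =
     (1 - (norm x)\<^sup>2) powr (1 + 2 * lam) / norm (x - \<zeta>) powr (real CARD('n) + 2 * lam)"

text \<open>
  Maximum and minimum over the sphere of radius \<open>r\<close> centred at the origin. The operators
  \<open>Max\<close> and \<open>Min\<close> are specified only for finite sets, and \<open>Sup\<close> and \<open>Inf\<close> need not be attained,
  so the greatest and least element of the image are used. They exist whenever \<open>u\<close> is
  continuous on the sphere and the sphere is nonempty.
\<close>

definition sphere_max :: "(real ^ 'n \<Rightarrow> real) \<Rightarrow> real \<Rightarrow> real" where
  "sphere_max u r = (GREATEST y. y \<in> u ` sphere 0 r)"

definition sphere_min :: "(real ^ 'n \<Rightarrow> real) \<Rightarrow> real \<Rightarrow> real" where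
  "sphere_min u r = (LEAST y. y \<in> u ` sphere 0 r)"

end

theory Submission
  imports Defs
begin

text \<open>
  Write \<open>s = n + 2 * lam\<close>. Since \<open>1 - r\<^sup>2 = (1 - r) * (1 + r)\<close>, multiplying the kernel at \<open>r *\<^sub>R e\<close>
  by the two weights of the theorem turns it into a single power,
  \<open>((1 - r) / norm (r *\<^sub>R e - z)) powr s\<close> and \<open>((1 + r) / norm (r *\<^sub>R e - z)) powr s\<close>
  (\<open>poisson_kernel_weight_minus\<close>, \<open>poisson_kernel_weight_plus\<close>). Along every ray, the first
  quotient decreases in \<open>r\<close> and the second increases, whatever the boundary point \<open>z\<close>
  (\<open>ray_quotient_minus_antimono\<close>, \<open>ray_quotient_plus_mono\<close>). The sign of \<open>s\<close> decides whether the
  powers keep these directions, which is where the two ranges of \<open>lam\<close> come from.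

  Integration over \<open>z\<close> preserves the comparison of weighted kernels, so the weighted \<open>u\<close> is monotone
  along each ray. Applied to the ray through a point where \<open>u\<close> is extremal on the sphere of radius
  \<open>r\<close>, this bounds the extremum there by the one on the sphere of radius \<open>r'\<close>. The extrema exist
  because \<open>u\<close> is continuous on these spheres (\<open>continuous_on_poisson_integral\<close>).
\<close>

section \<open>Extrema over spheres\<close>

lemma sphere_max_attained:
  fixes f :: "real ^ 'n \<Rightarrow> real"
  assumes "continuous_on (sphere 0 r) f" "0 \<le> r"
  shows "\<exists>x\<in>sphere 0 r. sphere_max f r = f x"
    and "\<And>y. y \<in> sphere 0 r \<Longrightarrow> f y \<le> sphere_max f r"
proof -
  have "sphere (0 :: real ^ 'n) r \<noteq> {}"
    using assms(2) by simp
  then obtain x where x: "x \<in> sphere 0 r" "\<And>y. y \<in> sphere 0 r \<Longrightarrow> f y \<le> f x"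
    using continuous_attains_sup[OF compact_sphere _ assms(1)] by blast
  have "sphere_max f r = f x"
    unfolding sphere_max_def using x by (intro Greatest_equality) auto
  then show "\<exists>x\<in>sphere 0 r. sphere_max f r = f x"
    and "\<And>y. y \<in> sphere 0 r \<Longrightarrow> f y \<le> sphere_max f r"
    using x by auto
qed

lemma sphere_min_attained:
  fixes f :: "real ^ 'n \<Rightarrow> real"
  assumes "continuous_on (sphere 0 r) f" "0 \<le> r"
  shows "\<exists>x\<in>sphere 0 r. sphere_min f r = f x"
    and "\<And>y. y \<in> sphere 0 r \<Longrightarrow> sphere_min f r \<le> f y"
proof -
  have "sphere (0 :: real ^ 'n) r \<noteq> {}"
    using assms(2) by simp
  then obtain x where x: "x \<in> sphere 0 r" "\<And>y. y \<in> sphere 0 r \<Longrightarrow> f x \<le> f y"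
    using continuous_attains_inf[OF compact_sphere _ assms(1)] by blast
  have "sphere_min f r = f x"
    unfolding sphere_min_def using x by (intro Least_equality) auto
  then show "\<exists>x\<in>sphere 0 r. sphere_min f r = f x"
    and "\<And>y. y \<in> sphere 0 r \<Longrightarrow> sphere_min f r \<le> f y"
    using x by auto
qed

lemma sphere_polar:
  fixes x :: "real ^ 'n"
  assumes "x \<in> sphere 0 r"
  obtains e where "norm e = 1" "x = r *\<^sub>R e"
proof (cases "x = 0")
  case True
  \<comment> \<open>Here \<open>r = 0\<close>, and every direction does.\<close>
  obtain e :: "real ^ 'n" where "norm e = 1"
    using vector_choose_size[of 1] by auto
  then show thesis
    using that[of e] True assms by simp
next
  case False
  then show thesis
    using that[of "x /\<^sub>R norm x"] assms by force
qed

text \<open>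
  The point on the inner sphere that is compared with an extremal point of the outer sphere is the
  one in the same direction.
\<close>

lemma weighted_sphere_max_mono:
  fixes f :: "real ^ 'n \<Rightarrow> real"
  assumes "continuous_on (sphere 0 r) f" "continuous_on (sphere 0 r') f"
    and "0 \<le> r" "0 \<le> r'" "0 \<le> c'"
    and ray: "\<And>e. norm e = 1 \<Longrightarrow> c * f (r *\<^sub>R e) \<le> c' * f (r' *\<^sub>R e)"
  shows "c * sphere_max f r \<le> c' * sphere_max f r'"
proof -
  obtain x where x: "x \<in> sphere 0 r" "sphere_max f r = f x"
    using sphere_max_attained(1) assms by blast
  obtain e where e: "norm e = 1" "x = r *\<^sub>R e"
    using sphere_polar x(1) by blast
  have "c * sphere_max f r \<le> c' * f (r' *\<^sub>R e)"
    using ray e x by simp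
  also have "\<dots> \<le> c' * sphere_max f r'"
    using assms e by (intro mult_left_mono sphere_max_attained(2)) auto
  finally show ?thesis .
qed

lemma weighted_sphere_min_mono:
  fixes f :: "real ^ 'n \<Rightarrow> real"
  assumes "continuous_on (sphere 0 r) f" "continuous_on (sphere 0 r') f"
    and "0 \<le> r" "0 \<le> r'" "0 \<le> c'"
    and ray: "\<And>e. norm e = 1 \<Longrightarrow> c' * f (r' *\<^sub>R e) \<le> c * f (r *\<^sub>R e)"
  shows "c' * sphere_min f r' \<le> c * sphere_min f r"
proof -
  obtain x where x: "x \<in> sphere 0 r" "sphere_min f r = f x"
    using sphere_min_attained(1) assms by blast
  obtain e where e: "norm e = 1" "x = r *\<^sub>R e"
    using sphere_polar x(1) by blast
  have "c' * sphere_min f r' \<le> c' * f (r' *\<^sub>R e)"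
    using assms e by (intro mult_left_mono sphere_min_attained(2)) auto
  also have "\<dots> \<le> c * sphere_min f r"
    using ray e x by simp
  finally show ?thesis .
qed

section \<open>Monotonicity of the weighted kernel along rays\<close>

lemma norm_ray_diff_squared:
  fixes e z :: "'a :: real_inner"
  assumes "norm e = 1" "norm z = 1"
  shows "(norm (r *\<^sub>R e - z))\<^sup>2 = 1 + r\<^sup>2 - 2 * r * (e \<bullet> z)"
proof -
  have "e \<bullet> e = 1" "z \<bullet> z = 1"
    using assms by (simp_all add: norm_eq_1)
  then show ?thesis
    unfolding power2_norm_eq_inner
    by (simp add: inner_diff inner_commute power2_eq_square algebra_simps)
qed

lemma norm_ray_diff_pos:
  fixes e z :: "'a :: real_normed_vector"
  assumes "norm e = 1" "norm z = 1" "0 \<le> r" "r < 1"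
  shows "0 < norm (r *\<^sub>R e - z)"
  using assms by auto

text \<open>
  With \<open>t = e \<bullet> z\<close>, the inverse square of the quotient is
  \<open>1 + 2 * (1 - t) * r / (1 - r)\<^sup>2\<close>, and \<open>r / (1 - r)\<^sup>2\<close> increases.
\<close>

lemma ray_quotient_minus_antimono:
  fixes e z :: "'a :: real_inner"
  assumes "norm e = 1" "norm z = 1" "0 \<le> r'" "r' \<le> r" "r < 1"
  shows "(1 - r) / norm (r *\<^sub>R e - z) \<le> (1 - r') / norm (r' *\<^sub>R e - z)"
proof -
  define t where "t = e \<bullet> z"
  have t: "t \<le> 1"
    using norm_cauchy_schwarz[of e z] assms by (simp add: t_def)
  have "(1 - r)\<^sup>2 * r' \<le> (1 - r')\<^sup>2 * r"
    using assms by (intro mult_mono power_mono) auto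
  then have "(1 - r)\<^sup>2 * r' * (2 * (1 - t)) \<le> (1 - r')\<^sup>2 * r * (2 * (1 - t))"
    using t by (intro mult_right_mono) auto
  then have "(1 - r)\<^sup>2 * (1 + r'\<^sup>2 - 2 * r' * t) \<le> (1 - r')\<^sup>2 * (1 + r\<^sup>2 - 2 * r * t)"
    by (simp add: power2_eq_square algebra_simps)
  then have "((1 - r) * norm (r' *\<^sub>R e - z))\<^sup>2 \<le> ((1 - r') * norm (r *\<^sub>R e - z))\<^sup>2"
    using assms by (simp add: power_mult_distrib norm_ray_diff_squared t_def)
  then have "(1 - r) * norm (r' *\<^sub>R e - z) \<le> (1 - r') * norm (r *\<^sub>R e - z)"
    by (rule power2_le_imp_le) (use assms in auto)
  moreover have "0 < norm (r *\<^sub>R e - z)" "0 < norm (r' *\<^sub>R e - z)"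
    using assms by (auto intro!: norm_ray_diff_pos simp del: zero_less_norm_iff)
  ultimately show ?thesis
    by (simp add: divide_simps mult.commute del: zero_less_norm_iff)
qed

text \<open>
  With \<open>t = e \<bullet> z\<close>, the inverse square of the quotient is
  \<open>1 - 2 * (1 + t) * r / (1 + r)\<^sup>2\<close>, and \<open>r / (1 + r)\<^sup>2\<close> increases on the unit interval because the
  cross difference \<open>r * (1 + r')\<^sup>2 - r' * (1 + r)\<^sup>2\<close> is \<open>(r - r') * (1 - r * r')\<close>.
\<close>

lemma ray_quotient_plus_mono:
  fixes e z :: "'a :: real_inner"
  assumes "norm e = 1" "norm z = 1" "0 \<le> r'" "r' \<le> r" "r < 1"
  shows "(1 + r') / norm (r' *\<^sub>R e - z) \<le> (1 + r) / norm (r *\<^sub>R e - z)"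
proof -
  define t where "t = e \<bullet> z"
  have t: "- 1 \<le> t"
    using Cauchy_Schwarz_ineq2[of e z] assms by (simp add: t_def)
  have "r * r' \<le> 1"
    using mult_mono[of r 1 r' 1] assms by simp
  then have "0 \<le> (r - r') * (1 - r * r')"
    using assms by simp
  then have "(1 + r)\<^sup>2 * r' \<le> (1 + r')\<^sup>2 * r"
    by (simp add: power2_eq_square algebra_simps)
  then have "(1 + r)\<^sup>2 * r' * (2 * (1 + t)) \<le> (1 + r')\<^sup>2 * r * (2 * (1 + t))"
    using t by (intro mult_right_mono) auto
  then have "(1 + r')\<^sup>2 * (1 + r\<^sup>2 - 2 * r * t) \<le> (1 + r)\<^sup>2 * (1 + r'\<^sup>2 - 2 * r' * t)"
    by (simp add: power2_eq_square algebra_simps)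
  then have "((1 + r') * norm (r *\<^sub>R e - z))\<^sup>2 \<le> ((1 + r) * norm (r' *\<^sub>R e - z))\<^sup>2"
    using assms by (simp add: power_mult_distrib norm_ray_diff_squared t_def)
  then have "(1 + r') * norm (r *\<^sub>R e - z) \<le> (1 + r) * norm (r' *\<^sub>R e - z)"
    by (rule power2_le_imp_le) (use assms in auto)
  moreover have "0 < norm (r *\<^sub>R e - z)" "0 < norm (r' *\<^sub>R e - z)"
    using assms by (auto intro!: norm_ray_diff_pos simp del: zero_less_norm_iff)
  ultimately show ?thesis
    by (simp add: divide_simps mult.commute del: zero_less_norm_iff)
qed

text \<open>
  The power of \<open>1 - r\<close> or \<open>1 + r\<close> from the weight completes the matching factor of
  \<open>(1 - r\<^sup>2) powr (1 + 2 * lam)\<close> to the exponent \<open>n + 2 * lam\<close> of the denominator, and the other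
  factor cancels.
\<close>

lemma powr_weight_collect:
  fixes a b d :: real
  assumes "0 < a" "0 < b" "0 < d"
  shows "a ^ (CARD('n::finite) - 1) / b powr q * ((a * b) powr q / d powr (real CARD('n) - 1 + q))
    = (a / d) powr (real CARD('n) - 1 + q)"
proof -
  have "real (CARD('n) - 1) = real CARD('n) - 1"
    by (simp add: of_nat_diff)
  then have "a ^ (CARD('n) - 1) * a powr q = a powr (real CARD('n) - 1 + q)"
    using assms by (simp add: powr_add powr_realpow[symmetric])
  then show ?thesis
    using assms by (simp add: powr_mult powr_divide field_simps)
qed

lemma poisson_kernel_weight_minus:
  fixes e z :: "real ^ 'n"
  assumes "norm e = 1" "norm z = 1" "0 \<le> r" "r < 1"
  shows "(1 - r) ^ (CARD('n) - 1) / (1 + r) powr (1 + 2 * lam) * poisson_kernel lam (r *\<^sub>R e) z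
    = ((1 - r) / norm (r *\<^sub>R e - z)) powr (real CARD('n) + 2 * lam)"
proof -
  have "1 - (norm (r *\<^sub>R e))\<^sup>2 = (1 - r) * (1 + r)"
    using assms by (simp add: power2_eq_square algebra_simps)
  then show ?thesis
    using powr_weight_collect[of "1 - r" "1 + r" "norm (r *\<^sub>R e - z)" "1 + 2 * lam", where 'n = 'n]
      norm_ray_diff_pos[OF assms] assms
    by (simp add: poisson_kernel_def)
qed

lemma poisson_kernel_weight_plus:
  fixes e z :: "real ^ 'n"
  assumes "norm e = 1" "norm z = 1" "0 \<le> r" "r < 1"
  shows "(1 + r) ^ (CARD('n) - 1) / (1 - r) powr (1 + 2 * lam) * poisson_kernel lam (r *\<^sub>R e) z
    = ((1 + r) / norm (r *\<^sub>R e - z)) powr (real CARD('n) + 2 * lam)"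
proof -
  have "1 - (norm (r *\<^sub>R e))\<^sup>2 = (1 + r) * (1 - r)"
    using assms by (simp add: power2_eq_square algebra_simps)
  then show ?thesis
    using powr_weight_collect[of "1 + r" "1 - r" "norm (r *\<^sub>R e - z)" "1 + 2 * lam", where 'n = 'n]
      norm_ray_diff_pos[OF assms] assms
    by (simp add: poisson_kernel_def)
qed

section \<open>Continuity of Poisson integrals\<close>

lemma continuous_on_poisson_kernel:
  "continuous_on (ball 0 1 \<times> sphere 0 1)
    (\<lambda>p :: (real ^ 'n) \<times> (real ^ 'n). poisson_kernel lam (fst p) (snd p))"
  unfolding poisson_kernel_def
  by (intro continuous_intros) (auto simp: abs_square_eq_1)

text \<open>
  At the origin the kernel is constantly 1, so its integrability there says that the measure is
  finite. On the product of a compact subset of the ball with the boundary sphere the kernel is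
  bounded by a constant, which is then an integrable majorant for dominated convergence.
\<close>

lemma continuous_on_poisson_integral:
  fixes \<mu> :: "(real ^ 'n) measure"
  assumes space: "space \<mu> = sphere 0 1"
    and int: "\<And>x. x \<in> ball 0 1 \<Longrightarrow> integrable \<mu> (poisson_kernel lam x)"
    and K: "compact K" "K \<subseteq> ball 0 1"
  shows "continuous_on K (\<lambda>x. LINT \<xi>|\<mu>. poisson_kernel lam x \<xi>)"
proof -
  have "integrable \<mu> (\<lambda>_. 1 :: real)"
    using int[of 0] by (rule Bochner_Integration.integrable_cong[THEN iffD1, rotated 2])
      (auto simp: space poisson_kernel_def)
  then have const: "integrable \<mu> (\<lambda>_. B)" for B :: real
    using integrable_mult_right[of B \<mu> "\<lambda>_. 1"] by simp
  have cont: "continuous_on (K \<times> sphere 0 1)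
      (\<lambda>p :: (real ^ 'n) \<times> (real ^ 'n). poisson_kernel lam (fst p) (snd p))"
    using K by (intro continuous_on_subset[OF continuous_on_poisson_kernel]) auto
  have "bounded ((\<lambda>p. poisson_kernel lam (fst p) (snd p)) ` (K \<times> sphere (0 :: real ^ 'n) 1))"
    using K by (intro compact_imp_bounded compact_continuous_image[OF cont] compact_Times) auto
  then obtain B where B: "\<And>x z. x \<in> K \<Longrightarrow> z \<in> sphere 0 1 \<Longrightarrow> norm (poisson_kernel lam x z) \<le> B"
    unfolding bounded_iff by fastforce
  show ?thesis
    unfolding continuous_on_sequentially
  proof (intro allI ballI impI, unfold comp_def)
    fix X and a
    assume a: "a \<in> K" and X: "(\<forall>k. X k \<in> K) \<and> X \<longlonglongrightarrow> a"
    show "(\<lambda>k. LINT \<xi>|\<mu>. poisson_kernel lam (X k) \<xi>) \<longlonglongrightarrow> (LINT \<xi>|\<mu>. poisson_kernel lam a \<xi>)"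
    proof (rule integral_dominated_convergence[where w = "\<lambda>_. B"])
      show "AE z in \<mu>. (\<lambda>k. poisson_kernel lam (X k) z) \<longlonglongrightarrow> poisson_kernel lam a z"
      proof (rule AE_I2)
        fix z
        assume "z \<in> space \<mu>"
        then show "(\<lambda>k. poisson_kernel lam (X k) z) \<longlonglongrightarrow> poisson_kernel lam a z"
          using continuous_on_tendsto_compose[OF cont, of "\<lambda>k. (X k, z)" "(a, z)" sequentially]
            X a space tendsto_Pair[of X a sequentially "\<lambda>_. z" z] by auto
      qed
      show "poisson_kernel lam a \<in> borel_measurable \<mu>"
        and "\<And>k. poisson_kernel lam (X k) \<in> borel_measurable \<mu>"
        using X a by (auto intro!: borel_measurable_integrable int subsetD[OF K(2)] simp del: mem_ball)
      show "\<And>k. AE z in \<mu>. norm (poisson_kernel lam (X k) z) \<le> B"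
        using B X space by (intro AE_I2) auto
    qed (rule const)
  qed
qed

section \<open>Growth of positive Poisson integrals\<close>

theorem corollary1p7:
  fixes lam r r' :: real
    and \<mu> :: "(real ^ 'n) measure"
    and u :: "real ^ 'n \<Rightarrow> real"
  assumes n: "CARD('n) \<ge> 2"
    and borel_measure: "sets \<mu> = sets (restrict_space borel (sphere 0 1))"
    and u: "\<And>x. x \<in> ball 0 1 \<Longrightarrow> u x = (LINT \<xi>|\<mu>. poisson_kernel lam x \<xi>)"
    and u_finite: "\<And>x. x \<in> ball 0 1 \<Longrightarrow> integrable \<mu> (poisson_kernel lam x)"
    and u_pos: "\<And>x. x \<in> ball 0 1 \<Longrightarrow> 0 < u x"
    and r: "0 \<le> r'" "r' \<le> r" "r < 1"
  shows
    "(lam > - real CARD('n) / 2 \<longrightarrow>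
        (1 - r) ^ (CARD('n) - 1) / (1 + r) powr (1 + 2 * lam) * sphere_max u r
          \<le> (1 - r') ^ (CARD('n) - 1) / (1 + r') powr (1 + 2 * lam) * sphere_max u r'
      \<and> (1 + r) ^ (CARD('n) - 1) / (1 - r) powr (1 + 2 * lam) * sphere_min u r
          \<ge> (1 + r') ^ (CARD('n) - 1) / (1 - r') powr (1 + 2 * lam) * sphere_min u r')
   \<and> (lam < - real CARD('n) / 2 \<longrightarrow>
        (1 + r) ^ (CARD('n) - 1) / (1 - r) powr (1 + 2 * lam) * sphere_max u r
          \<le> (1 + r') ^ (CARD('n) - 1) / (1 - r') powr (1 + 2 * lam) * sphere_max u r'
      \<and> (1 - r) ^ (CARD('n) - 1) / (1 + r) powr (1 + 2 * lam) * sphere_min u r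
          \<ge> (1 - r') ^ (CARD('n) - 1) / (1 + r') powr (1 + 2 * lam) * sphere_min u r')"
proof -
  let ?s = "real CARD('n) + 2 * lam"
  let ?A = "\<lambda>\<rho>. (1 - \<rho>) ^ (CARD('n) - 1) / (1 + \<rho>) powr (1 + 2 * lam)"
  let ?B = "\<lambda>\<rho>. (1 + \<rho>) ^ (CARD('n) - 1) / (1 - \<rho>) powr (1 + 2 * lam)"
  have space: "space \<mu> = sphere 0 1"
    using sets_eq_imp_space_eq[OF borel_measure] by (simp add: space_restrict_space)
  have cont: "continuous_on (sphere 0 \<rho>) u" if "\<rho> < 1" for \<rho>
  proof -
    have sub: "sphere 0 \<rho> \<subseteq> (ball 0 1 :: (real ^ 'n) set)"
      using that by auto
    have "continuous_on (sphere 0 \<rho>) (\<lambda>x. LINT \<xi>|\<mu>. poisson_kernel lam x \<xi>)"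
      using space u_finite sub by (intro continuous_on_poisson_integral) auto
    then show ?thesis
      using u sub by (subst continuous_on_cong[OF refl u]) auto
  qed
  \<comment> \<open>Comparisons of weighted kernels integrate; radii and weights stay free, since both directions
    between \<open>r\<close> and \<open>r'\<close> occur.\<close>
  have integrate: "c * u (\<rho> *\<^sub>R e) \<le> d * u (\<sigma> *\<^sub>R e)"
    if "norm e = 1" "0 \<le> \<rho>" "\<rho> < 1" "0 \<le> \<sigma>" "\<sigma> < 1"
      and le: "\<And>z. norm z = 1 \<Longrightarrow>
        c * poisson_kernel lam (\<rho> *\<^sub>R e) z \<le> d * poisson_kernel lam (\<sigma> *\<^sub>R e) z"
    for c d \<rho> \<sigma> e
  proof -
    have b: "\<rho> *\<^sub>R e \<in> ball 0 1" "\<sigma> *\<^sub>R e \<in> ball 0 1"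
      using that by auto
    have "(LINT z|\<mu>. c * poisson_kernel lam (\<rho> *\<^sub>R e) z) \<le> (LINT z|\<mu>. d * poisson_kernel lam (\<sigma> *\<^sub>R e) z)"
      using le space u_finite[OF b(1)] u_finite[OF b(2)]
      by (intro integral_mono integrable_mult_right) auto
    then show ?thesis
      using u[OF b(1)] u[OF b(2)] by simp
  qed
  have bounds: "0 \<le> r" "r' < 1"
    using r by auto
  have weights: "0 \<le> ?A r'" "0 \<le> ?B r'"
    using r by auto
  note minus = ray_quotient_minus_antimono[OF _ _ r] and plus = ray_quotient_plus_mono[OF _ _ r]
  have nonneg: "0 \<le> (1 - r) / norm w" "0 \<le> (1 - r') / norm w"
    "0 \<le> (1 + r) / norm w" "0 \<le> (1 + r') / norm w" for w :: "real ^ 'n"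
    using r by auto
  have pos: "0 < (1 - \<rho>) / norm (\<rho> *\<^sub>R e - z)" "0 < (1 + \<rho>) / norm (\<rho> *\<^sub>R e - z)"
    if "norm e = 1" "norm z = 1" "0 \<le> \<rho>" "\<rho> < 1" for \<rho> and e z :: "real ^ 'n"
    using norm_ray_diff_pos[OF that] that by (auto intro!: divide_pos_pos simp del: zero_less_norm_iff)
  show ?thesis
  proof (intro conjI impI)
    assume "lam > - real CARD('n) / 2"
    then have s: "0 \<le> ?s"
      by simp
    show "?A r * sphere_max u r \<le> ?A r' * sphere_max u r'"
      using r bounds weights
      by (intro weighted_sphere_max_mono cont integrate)
        (auto simp only: poisson_kernel_weight_minus intro!: powr_mono2 s minus nonneg)
    show "?B r * sphere_min u r \<ge> ?B r' * sphere_min u r'"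
      using r bounds weights
      by (intro weighted_sphere_min_mono cont integrate)
        (auto simp only: poisson_kernel_weight_plus intro!: powr_mono2 s plus nonneg)
  next
    assume "lam < - real CARD('n) / 2"
    then have s: "?s \<le> 0"
      by simp
    show "?B r * sphere_max u r \<le> ?B r' * sphere_max u r'"
      using r bounds weights
      by (intro weighted_sphere_max_mono cont integrate)
        (auto simp only: poisson_kernel_weight_plus intro!: powr_mono2' s plus pos)
    show "?A r * sphere_min u r \<ge> ?A r' * sphere_min u r'"
      using r bounds weights
      by (intro weighted_sphere_min_mono cont integrate)
        (auto simp only: poisson_kernel_weight_minus intro!: powr_mono2' s minus pos)
  qed
qed

end
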